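(* Let $q\ge1$, $\gamma>0$, and let $\{m_{2k}\}_{k=1}^\infty$, $\{\kappa_l\}_{l=1}^\infty$ be real sequences such that $\{\kappa_l\}_{l=1}^\infty=\mathrm{T}^{q,\gamma}_{m\to\kappa}(\{m_{2k}\}_{k=1}^\infty)$. Then $\kappa_l=0$ for all odd $l$ and, as formal power series in $y$, $$\exp\Bigl[\gamma\sum_{k=1}^\infty\frac{m_{2k}}{k}y^{2k}\Bigr]=\sum_{n=0}^\infty c_n\,y^{2n},\qquad \exp\Bigl[\sum_{l=1}^\infty\frac{\kappa_{2l}}{2l}y^{2l}\Bigr]=\sum_{n=0}^\infty\frac{c_n}{(\gamma)_n(q\gamma)_n}2^{-2n}y^{2n}$$ for some (the same) auxiliary sequence $\{c_n\}_{n=0}^\infty$. Equivalently, $$\exp\Bigl[\sum_{l=1}^\infty\frac{\kappa_{2l}}{2l}y^{2l}\Bigr]=[z^0]\Bigl\{\sum_{n=0}^\infty\frac{(yz)^{2n}}{(\gamma)_n(q\gamma)_n}2^{-2n}\cdot\exp\Bigl[\gamma\sum_{k=1}^\infty\frac{m_{2k}}{k}z^{-2k}\Bigr]\Bigr\}.$$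
   Context: $(x)_0=1$ and $(x)_n=x(x+1)\cdots(x+n-1)$ for $n\ge1$; $[z^0]$ takes the coefficient of $z^0$ (coefficientwise in $y$). The map $\mathrm{T}^{q,\gamma}_{m\to\kappa}$. On formal power series $\mathbb{R}[[z]]$ define linear operators: $\partial(z^n)=nz^{n-1}$; $d(z^n)=z^{n-1}$ for $n\ge1$, $d(1)=0$; $d'(z^n)=2z^{n-1}$ for $n$ odd and $0$ for $n$ even; $*_g$ is multiplication by $g(z)$. $\mathrm{T}^{q,\gamma}_{\kappa\to m}$ sends a real sequence $\{\kappa_l\}_{l\ge1}$ to $\{m_{2k}\}_{k\ge1}$, where $$m_{2k}=[z^0]\bigl(\partial+2\gamma d+((q-1)\gamma-\tfrac12)d'+*_g\bigr)^{2k-1}g(z),\qquad g(z)=\sum_{l=1}^\infty\kappa_lz^{l-1}.$$ For every real sequence $\{m_{2k}\}_{k\ge1}$ there is a unique real sequence $\{\kappa_l\}_{l\ge1}$ with $\kappa_l=0$ for all odd $l$ and $\mathrm{T}^{q,\gamma}_{\kappa\to m}(\{\kappa_l\})=\{m_{2k}\}$; it is denoted $\mathrm{T}^{q,\gamma}_{m\to\kappa}(\{m_{2k}\})$. *)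

theory Defs
  imports
    "HOL-Computational_Algebra.Formal_Power_Series"
    "HOL-Computational_Algebra.Formal_Laurent_Series"
begin

text \<open>
  Sequences indexed by \<open>l \<ge> 1\<close> are functions on \<^typ>\<open>nat\<close> whose value at \<open>0\<close> is irrelevant.
  A sequence \<open>m\<^sub>2, m\<^sub>4, m\<^sub>6, \<dots>\<close> is passed to the maps below as the function
  \<open>k \<mapsto> m\<^sub>2\<^sub>k\<close>.
\<close>

definition dprime :: "real fps \<Rightarrow> real fps" where
  "dprime f = Abs_fps (\<lambda>n. if odd (n + 1) then 2 * fps_nth f (n + 1) else 0)"

lemma dprime_power: "dprime (fps_X ^ n) = (if odd n then 2 * fps_X ^ (n - 1) else 0)"
  by (cases n; rule fps_ext) (auto simp: dprime_def fps_X_power_nth numeral_fps_const)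

text \<open>\<^term>\<open>fps_shift 1\<close> is the operator \<open>d\<close>, sending \<open>z\<^sup>n\<close> to \<open>z\<^sup>n\<^sup>-\<^sup>1\<close> for \<open>n \<ge> 1\<close> and \<open>1\<close> to \<open>0\<close>.\<close>

definition T_op :: "real \<Rightarrow> real \<Rightarrow> real fps \<Rightarrow> real fps \<Rightarrow> real fps" where
  "T_op q \<gamma> g f =
     fps_deriv f + fps_const (2 * \<gamma>) * fps_shift 1 f
       + fps_const ((q - 1) * \<gamma> - 1 / 2) * dprime f + g * f"

definition T_kappa_to_m :: "real \<Rightarrow> real \<Rightarrow> (nat \<Rightarrow> real) \<Rightarrow> nat \<Rightarrow> real" where
  "T_kappa_to_m q \<gamma> \<kappa> k =
     (let g = Abs_fps (\<lambda>n. \<kappa> (n + 1)) in fps_nth ((T_op q \<gamma> g ^^ (2 * k - 1)) g) 0)"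

text \<open>The value at the unused index \<open>0\<close> is fixed to be \<open>0\<close> so that the sequence is unique as a
  function on \<^typ>\<open>nat\<close>.\<close>

definition T_m_to_kappa :: "real \<Rightarrow> real \<Rightarrow> (nat \<Rightarrow> real) \<Rightarrow> nat \<Rightarrow> real" where
  "T_m_to_kappa q \<gamma> M =
     (THE \<kappa>. \<kappa> 0 = 0 \<and> (\<forall>l. odd l \<longrightarrow> \<kappa> l = 0) \<and> (\<forall>k\<ge>1. T_kappa_to_m q \<gamma> \<kappa> k = M k))"

text \<open>\<open>\<Sum>\<^sub>n a\<^sub>n y\<^sup>2\<^sup>n\<close>, over \<open>n \<ge> 0\<close> and over \<open>n \<ge> 1\<close> respectively.\<close>

definition even_fps :: "(nat \<Rightarrow> 'a::zero) \<Rightarrow> 'a fps" where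
  "even_fps a = Abs_fps (\<lambda>j. if even j then a (j div 2) else 0)"

definition even_fps1 :: "(nat \<Rightarrow> 'a::zero) \<Rightarrow> 'a fps" where
  "even_fps1 a = even_fps (\<lambda>n. if n = 0 then 0 else a n)"

text \<open>Meaningful only for a series without constant term.\<close>

definition exp_fps :: "real fps \<Rightarrow> real fps" where
  "exp_fps f = fps_exp 1 oo f"

text \<open>
  Series mixing powers of \<open>y\<close> with powers of \<open>z\<close> and \<open>z\<^sup>-\<^sup>1\<close> are power series in \<open>y\<close> whose
  coefficients are formal Laurent series in the variable \<open>w = z\<^sup>-\<^sup>1\<close>: they may involve infinitely many
  negative but only finitely many positive powers of \<open>z\<close>. Thus \<open>z\<close> is \<^term>\<open>fls_X_inv\<close>, and a
  power series in \<open>z\<^sup>-\<^sup>1\<close> is embedded by \<^term>\<open>fps_to_fls\<close>.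
\<close>

definition coeff_z0 :: "real fls fps \<Rightarrow> real fps" where
  "coeff_z0 H = Abs_fps (\<lambda>j. fls_nth (fps_nth H j) 0)"

end

theory Submission
  imports Defs
begin

text \<open>
  Let \<open>D\<close> be the operator in the definition of the map, \<open>A = D - *\<^sub>g\<close> its part without the
  multiplication, and \<open>E = exp (\<Sum> \<kappa>\<^sub>2\<^sub>l z\<^sup>2\<^sup>l / 2l)\<close>. As \<open>D 1 = g\<close>, one has
  \<open>m\<^sub>2\<^sub>k = [z\<^sup>0] D\<^sup>2\<^sup>k 1\<close>. Since \<open>E' = g E\<close> and \<open>E\<close> is even, multiplication by \<open>E\<close> conjugates \<open>D\<close>
  into \<open>A\<close> up to a rank-one term: \<open>E (D f) = A (E f) - 2 \<gamma> f(0) (E - 1) / z\<close>. Iterating from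
  \<open>f = 1\<close> and using that \<open>A\<close> maps \<open>z\<^sup>n\<close> to a multiple of \<open>z\<^sup>n\<^sup>-\<^sup>1\<close> yields a convolution recurrence
  between the \<open>m\<^sub>2\<^sub>k\<close> and the coefficients of \<open>E\<close>; for \<open>c\<^sub>n = 4\<^sup>n (\<gamma>)\<^sub>n (q\<gamma>)\<^sub>n [z\<^sup>2\<^sup>n] E\<close> it reads
  \<open>n c\<^sub>n = \<gamma> \<Sum> m\<^sub>2\<^sub>j c\<^sub>n\<^sub>-\<^sub>j\<close> (\<open>1 \<le> j \<le> n\<close>), the logarithmic derivative of the claimed identity. That
  identity is a bijection between the sequences, so the description in the definition of
  \<^const>\<open>T_m_to_kappa\<close> is satisfied by exactly one sequence.
\<close>

section \<open>Exponentials of power series through the logarithmic derivative\<close>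

lemma exp_fps_nth_0 [simp]: "fps_nth (exp_fps f) 0 = 1"
  by (simp add: exp_fps_def)

lemma fps_deriv_exp_fps:
  assumes "fps_nth f 0 = 0"
  shows "fps_deriv (exp_fps f) = exp_fps f * fps_deriv f"
  using assms by (simp add: exp_fps_def fps_compose_deriv)

text \<open>The equation expresses (k+1) times coefficient k+1 of \<open>F\<close> through its
  coefficients up to k.\<close>

lemma fps_linear_ode_unique:
  fixes F G h :: "real fps"
  assumes "fps_deriv F = F * h" "fps_deriv G = G * h" "fps_nth F 0 = fps_nth G 0"
  shows "F = G"
proof (rule fps_ext)
  fix n
  show "fps_nth F n = fps_nth G n"
  proof (induction n rule: less_induct)
    case (less n)
    show ?case
    proof (cases n)
      case 0
      then show ?thesis using assms by simp
    next
      case (Suc k)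
      have "fps_nth (F * h) k = fps_nth (G * h) k"
        unfolding fps_mult_nth using less Suc by (intro sum.cong) auto
      then have "fps_nth (fps_deriv F) k = fps_nth (fps_deriv G) k"
        using assms by simp
      then show ?thesis using Suc by simp
    qed
  qed
qed

lemma exp_fps_eqI:
  assumes "fps_nth f 0 = 0" "fps_nth G 0 = 1" "fps_deriv G = G * fps_deriv f"
  shows "exp_fps f = G"
  by (rule fps_linear_ode_unique[OF fps_deriv_exp_fps[OF assms(1)] assms(3)]) (simp add: assms(2))

lemma exp_fps_inj:
  assumes "fps_nth f 0 = 0" "fps_nth g 0 = 0" "exp_fps f = exp_fps g"
  shows "f = g"
proof -
  have "exp_fps f * fps_deriv f = exp_fps f * fps_deriv g"
    using assms fps_deriv_exp_fps by metis
  moreover have "exp_fps f \<noteq> 0"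
    by (metis exp_fps_nth_0 fps_zero_nth zero_neq_one)
  ultimately have "fps_deriv f = fps_deriv g" by simp
  then show ?thesis
    using assms by (simp add: fps_deriv_eq_iff)
qed

text \<open>The logarithm is the antiderivative of G'/G without constant term; \<open>G\<close> is
  invertible since it starts with 1.\<close>

lemma exp_fps_surj:
  assumes "fps_nth G 0 = 1"
  obtains f where "fps_nth f 0 = 0" "exp_fps f = G"
proof
  define f where "f = fps_integral0 (fps_deriv G * inverse G)"
  show f0: "fps_nth f 0 = 0" by (simp add: f_def)
  have "G * fps_deriv f = fps_deriv G * (inverse G * G)"
    by (simp add: f_def fps_deriv_fps_integral mult_ac)
  also have "\<dots> = fps_deriv G"
    using assms by (simp add: inverse_mult_eq_1)
  finally show "exp_fps f = G" using exp_fps_eqI[OF f0 assms] by simp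
qed

text \<open>The series variable stands for y^2, which turns the even series of the theorem into
  plain coefficient sequences.\<close>

definition exp_seq :: "(nat \<Rightarrow> real) \<Rightarrow> nat \<Rightarrow> real" where
  "exp_seq a = fps_nth (exp_fps (Abs_fps (\<lambda>n. if n = 0 then 0 else a n)))"

lemma exp_seq_0 [simp]: "exp_seq a 0 = 1"
  by (simp add: exp_seq_def)

text \<open>The recurrence is the equation G' = G f' read off coefficientwise, with the index
  shifted by one.\<close>

lemma exp_seq_eqI:
  assumes "c 0 = 1"
    and rec: "\<And>n. n \<ge> 1 \<Longrightarrow> real n * c n = (\<Sum>j<n. c j * (real (n - j) * a (n - j)))"
  shows "exp_seq a = c"
proof -
  have "exp_fps (Abs_fps (\<lambda>n. if n = 0 then 0 else a n)) = Abs_fps c"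
  proof (rule exp_fps_eqI)
    show "fps_deriv (Abs_fps c) = Abs_fps c * fps_deriv (Abs_fps (\<lambda>n. if n = 0 then 0 else a n))"
    proof (rule fps_ext)
      fix k
      show "fps_nth (fps_deriv (Abs_fps c)) k
        = fps_nth (Abs_fps c * fps_deriv (Abs_fps (\<lambda>n. if n = 0 then 0 else a n))) k"
        using rec[of "Suc k"]
        by (simp add: fps_mult_nth lessThan_Suc_atMost atLeast0AtMost Suc_diff_le del: sum.lessThan_Suc)
    qed
  qed (use assms in auto)
  then show ?thesis by (simp add: exp_seq_def fun_eq_iff)
qed

lemma exp_seq_inj:
  assumes "exp_seq a = exp_seq b" "n \<ge> 1"
  shows "a n = b n"
proof -
  let ?f = "\<lambda>a. Abs_fps (\<lambda>n. if n = 0 then 0 else a n)"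
  have "?f a = ?f b"
  proof (rule exp_fps_inj)
    show "exp_fps (?f a) = exp_fps (?f b)"
      using assms(1) by (intro fps_ext) (simp only: exp_seq_def)
  qed simp_all
  then have "fps_nth (?f a) n = fps_nth (?f b) n" by simp
  then show ?thesis using assms by simp
qed

lemma exp_seq_cong:
  assumes "\<And>n. n \<ge> 1 \<Longrightarrow> a n = b n"
  shows "exp_seq a = exp_seq b"
proof -
  have "(\<lambda>n. if n = 0 then 0 else a n) = (\<lambda>n. if n = 0 then 0 else b n)"
    using assms by auto
  then show ?thesis by (simp add: exp_seq_def)
qed

lemma exp_seq_surj:
  assumes "c 0 = 1"
  obtains a where "exp_seq a = c"
proof -
  obtain f where f: "fps_nth f 0 = 0" "exp_fps f = Abs_fps c"
    using exp_fps_surj[of "Abs_fps c"] assms by auto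
  have "Abs_fps (\<lambda>n. if n = 0 then 0 else fps_nth f n) = f"
    using f by (auto simp: fps_eq_iff)
  then have "exp_seq (fps_nth f) = c"
    using f by (simp add: exp_seq_def fun_eq_iff)
  then show ?thesis by (rule that)
qed

section \<open>Series in even powers\<close>

lemma even_fps_nth: "fps_nth (even_fps a) j = (if even j then a (j div 2) else 0)"
  by (simp add: even_fps_def)

lemma even_fps_eq_compose:
  fixes a :: "nat \<Rightarrow> real"
  shows "even_fps a = Abs_fps a oo fps_X ^ 2"
proof (rule fps_ext)
  fix n
  have "fps_nth (Abs_fps a oo fps_X ^ 2) n = (\<Sum>i=0..n. if n = 2 * i then a i else 0)"
    unfolding fps_compose_nth by (intro sum.cong) (auto simp: fps_X_power_nth simp flip: power_mult)
  also have "\<dots> = fps_nth (even_fps a) n"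
    by (cases "even n") (auto simp: even_fps_nth elim!: evenE intro!: sum.neutral)
  finally show "fps_nth (even_fps a) n = fps_nth (Abs_fps a oo fps_X ^ 2) n" by simp
qed

text \<open>Passing to even powers is composition with x^2, and composition is associative.\<close>

lemma exp_fps_even_fps1: "exp_fps (even_fps1 a) = even_fps (exp_seq a)"
proof -
  have "Abs_fps (exp_seq a) = fps_exp 1 oo Abs_fps (\<lambda>n. if n = 0 then 0 else a n)"
    by (rule fps_ext) (simp add: exp_seq_def exp_fps_def)
  then show ?thesis
    by (simp add: exp_fps_def even_fps1_def even_fps_eq_compose fps_compose_assoc)
qed

section \<open>The operator and its conjugation by an even series\<close>

text \<open>\<open>dprime\<close> is 2/z times the projection to the odd part, and multiplication by
  an even series preserves parity.\<close>

lemma dprime_even_mult: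
  assumes "\<And>i. odd i \<Longrightarrow> fps_nth E i = 0"
  shows "dprime (E * f) = E * dprime f"
proof (rule fps_ext)
  fix n
  have "fps_nth (E * dprime f) n
    = (\<Sum>i\<le>n. fps_nth E i * (if even n then 2 * fps_nth f (Suc n - i) else 0))"
    unfolding fps_mult_nth atLeast0AtMost
    using assms by (intro sum.cong) (auto simp: dprime_def Suc_diff_le)
  also have "\<dots> = fps_nth (dprime (E * f)) n"
    using assms[of "Suc n"]
    by (auto simp: dprime_def fps_mult_nth atLeast0AtMost sum_distrib_left mult_ac)
  finally show "fps_nth (dprime (E * f)) n = fps_nth (E * dprime f) n" by simp
qed

text \<open>For \<open>n \<ge> 1\<close> the operator \<open>A\<close> sends \<open>z\<^sup>n\<close> to \<open>T_coeff q \<gamma> n \<cdot> z\<^sup>n\<^sup>-\<^sup>1\<close>; hence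
  \<open>T_weight q \<gamma> n = A\<^sup>n z\<^sup>n\<close>.\<close>

definition T_coeff :: "real \<Rightarrow> real \<Rightarrow> nat \<Rightarrow> real" where
  "T_coeff q \<gamma> n = real n + 2 * \<gamma> + (if odd n then 2 * ((q - 1) * \<gamma> - 1 / 2) else 0)"

definition T_weight :: "real \<Rightarrow> real \<Rightarrow> nat \<Rightarrow> real" where
  "T_weight q \<gamma> n = (\<Prod>j=1..n. T_coeff q \<gamma> j)"

lemma T_weight_0 [simp]: "T_weight q \<gamma> 0 = 1"
  by (simp add: T_weight_def)

lemma T_weight_Suc: "T_weight q \<gamma> (Suc n) = T_weight q \<gamma> n * T_coeff q \<gamma> (Suc n)"
  by (simp add: T_weight_def)

text \<open>\<open>T_coeff\<close> is 2(j + \<gamma>) at 2j and 2(j + q\<gamma>) at 2j+1. The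
  prefactor 2\<gamma> supplies the factor of the first kind for j = 0, which the product
  lacks.\<close>

lemma T_weight_odd:
  "2 * \<gamma> * T_weight q \<gamma> (2 * k + 1) = pochhammer \<gamma> (Suc k) * pochhammer (q * \<gamma>) (Suc k) * 4 ^ Suc k"
proof (induction k)
  case 0
  then show ?case by (simp add: T_weight_Suc T_coeff_def algebra_simps)
next
  case (Suc k)
  have "2 * \<gamma> * T_weight q \<gamma> (2 * Suc k + 1)
    = (2 * \<gamma> * T_weight q \<gamma> (2 * k + 1)) * (2 * (real k + 1) + 2 * \<gamma>) * (2 * (real k + 1) + 2 * q * \<gamma>)"
    by (simp add: T_weight_Suc T_coeff_def algebra_simps)
  also have "\<dots> = pochhammer \<gamma> (Suc (Suc k)) * pochhammer (q * \<gamma>) (Suc (Suc k)) * 4 ^ Suc (Suc k)"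
    unfolding Suc.IH pochhammer_Suc[of _ "Suc k"] by (simp add: algebra_simps)
  finally show ?case .
qed

text \<open>The product rule absorbs \<open>g * f\<close> and \<open>dprime\<close> commutes with
  \<open>E\<close>; only the shift leaves a defect, f(0) times the shifted \<open>E\<close>.\<close>

lemma T_op_conjugate:
  assumes E: "\<And>i. odd i \<Longrightarrow> fps_nth E i = 0" and dE: "fps_deriv E = g * E"
    and E0: "fps_nth E 0 = 1"
  shows "fps_nth (E * T_op q \<gamma> g f) i
    = T_coeff q \<gamma> (Suc i) * fps_nth (E * f) (Suc i) - 2 * \<gamma> * fps_nth f 0 * fps_nth E (Suc i)"
proof -
  have shift: "fps_nth (E * fps_shift 1 f) i
      = fps_nth (E * f) (Suc i) - fps_nth f 0 * fps_nth E (Suc i)"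
    by (auto simp: fps_mult_nth atLeast0AtMost Suc_diff_le intro!: sum.cong)
  have "E * T_op q \<gamma> g f = (E * fps_deriv f + fps_deriv E * f)
      + fps_const (2 * \<gamma>) * (E * fps_shift 1 f)
      + fps_const ((q - 1) * \<gamma> - 1 / 2) * (E * dprime f)"
    by (simp add: T_op_def dE algebra_simps)
  also have "E * fps_deriv f + fps_deriv E * f = fps_deriv (E * f)"
    by (simp add: algebra_simps)
  finally have "fps_nth (E * T_op q \<gamma> g f) i = fps_nth (fps_deriv (E * f)) i
      + 2 * \<gamma> * fps_nth (E * fps_shift 1 f) i
      + ((q - 1) * \<gamma> - 1 / 2) * fps_nth (dprime (E * f)) i"
    by (simp add: dprime_even_mult[OF E] del: fps_deriv_mult)
  then show ?thesis
    unfolding shift by (cases "even i") (simp_all add: dprime_def T_coeff_def algebra_simps del: fps_deriv_mult)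
qed

text \<open>Multiplied by \<open>T_weight q \<gamma> i\<close>, the conjugation rule trades one
  application of the operator for a step from i to i+1, hence the general i. Summand j is the defect
  of application j+1, carried through the n-1-j later ones.\<close>

lemma T_op_iterate:
  fixes q \<gamma> :: real and g E :: "real fps"
  assumes "\<And>i. odd i \<Longrightarrow> fps_nth E i = 0" "fps_deriv E = g * E" "fps_nth E 0 = 1"
  defines "M \<equiv> \<lambda>n. fps_nth ((T_op q \<gamma> g ^^ n) 1) 0"
  shows "T_weight q \<gamma> i * fps_nth (E * (T_op q \<gamma> g ^^ n) 1) i
    = T_weight q \<gamma> (n + i) * fps_nth E (n + i)
      - 2 * \<gamma> * (\<Sum>j<n. M j * (T_weight q \<gamma> (n - 1 - j + i) * fps_nth E (n - j + i)))"
proof (induction n arbitrary: i)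
  case 0
  then show ?case by simp
next
  case (Suc n)
  have "T_weight q \<gamma> i * fps_nth (E * (T_op q \<gamma> g ^^ Suc n) 1) i
    = T_weight q \<gamma> (Suc i) * fps_nth (E * (T_op q \<gamma> g ^^ n) 1) (Suc i)
      - 2 * \<gamma> * (M n * (T_weight q \<gamma> i * fps_nth E (Suc i)))"
    using T_op_conjugate[OF assms(1-3), of q \<gamma> "(T_op q \<gamma> g ^^ n) 1" i]
    by (simp add: M_def T_weight_Suc right_diff_distrib mult_ac)
  also have "\<dots> = T_weight q \<gamma> (Suc n + i) * fps_nth E (Suc n + i)
      - 2 * \<gamma> * ((\<Sum>j<n. M j * (T_weight q \<gamma> (n - 1 - j + Suc i) * fps_nth E (n - j + Suc i)))
        + M n * (T_weight q \<gamma> i * fps_nth E (Suc i)))"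
    unfolding Suc.IH by (simp add: algebra_simps)
  also have "(\<Sum>j<n. M j * (T_weight q \<gamma> (n - 1 - j + Suc i) * fps_nth E (n - j + Suc i)))
      = (\<Sum>j<n. M j * (T_weight q \<gamma> (Suc n - 1 - j + i) * fps_nth E (Suc n - j + i)))"
    by (intro sum.cong refl) (auto simp: Suc_diff_le Suc_diff_Suc)
  finally show ?case by simp
qed

section \<open>The relation between the two sequences\<close>

lemma sum_lessThan_double:
  fixes F :: "nat \<Rightarrow> 'a::comm_monoid_add"
  assumes "\<And>j. j < 2 * k \<Longrightarrow> odd j \<Longrightarrow> F j = 0"
  shows "(\<Sum>j<2 * k. F j) = (\<Sum>j<k. F (2 * j))"
  using assms by (induction k) auto

lemma T_kappa_to_m_eq:
  "k \<ge> 1 \<Longrightarrow> T_kappa_to_m q \<gamma> \<kappa> k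
    = fps_nth ((T_op q \<gamma> (Abs_fps (\<lambda>n. \<kappa> (n + 1))) ^^ (2 * k)) 1) 0"
proof -
  assume "k \<ge> 1"
  then obtain n where n: "2 * k = Suc n" by (cases k) auto
  have "T_op q \<gamma> g 1 = g" for g
    by (rule fps_ext) (simp add: T_op_def dprime_def)
  then show ?thesis
    unfolding T_kappa_to_m_def Let_def n by (simp add: funpow_Suc_right del: funpow.simps)
qed

text \<open>Stated for every \<open>\<kappa>\<close> vanishing at odd indices, so that it yields
  both the bijectivity of the map and the final identity.\<close>

lemma exp_seq_T_kappa_to_m:
  assumes "\<gamma> > 0" and \<kappa>: "\<And>l. odd l \<Longrightarrow> \<kappa> l = 0"
  shows "exp_seq (\<lambda>k. \<gamma> * (T_kappa_to_m q \<gamma> \<kappa> k / real k)) n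
    = pochhammer \<gamma> n * pochhammer (q * \<gamma>) n * 4 ^ n * exp_seq (\<lambda>l. \<kappa> (2 * l) / real (2 * l)) n"
proof -
  define e where "e = exp_seq (\<lambda>l. \<kappa> (2 * l) / real (2 * l))"
  define c where "c = (\<lambda>n. pochhammer \<gamma> n * pochhammer (q * \<gamma>) n * 4 ^ n * e n)"
  define g where "g = Abs_fps (\<lambda>n. \<kappa> (n + 1))"
  define f where "f = even_fps1 (\<lambda>l. \<kappa> (2 * l) / real (2 * l))"
  define M where "M = (\<lambda>n. fps_nth ((T_op q \<gamma> g ^^ n) 1) 0)"
  have f0: "fps_nth f 0 = 0" by (simp add: f_def even_fps1_def even_fps_nth)
  have f': "fps_deriv f = g"
  proof (rule fps_ext)
    fix n
    show "fps_nth (fps_deriv f) n = fps_nth g n"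
      using \<kappa>[of "Suc n"]
      by (cases "even (Suc n)")
         (auto simp: f_def g_def even_fps1_def even_fps_nth elim!: evenE oddE)
  qed
  have expf: "exp_fps f = even_fps e"
    by (simp add: f_def e_def exp_fps_even_fps1)
  have e0: "e 0 = 1" by (simp add: e_def)
  have dE: "fps_deriv (even_fps e) = g * even_fps e"
    using fps_deriv_exp_fps[OF f0] by (simp add: f' expf mult.commute)
  have main: "M n = T_weight q \<gamma> n * fps_nth (even_fps e) n
      - 2 * \<gamma> * (\<Sum>j<n. M j * (T_weight q \<gamma> (n - 1 - j) * fps_nth (even_fps e) (n - j)))" for n
    using T_op_iterate[of "even_fps e" g q \<gamma> 0 n] dE e0
    by (simp add: even_fps_nth M_def)
  \<comment> \<open>For odd n, each summand of \<open>main\<close> has either j odd, covered by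
    induction, or n - j odd, where the even series vanishes.\<close>
  have "M n = 0" if "odd n" for n
    using that
  proof (induction n rule: less_induct)
    case (less n)
    then have "M j * (T_weight q \<gamma> (n - 1 - j) * fps_nth (even_fps e) (n - j)) = 0" if "j < n" for j
      using that by (cases "odd j") (auto simp: even_fps_nth)
    then have "(\<Sum>j<n. M j * (T_weight q \<gamma> (n - 1 - j) * fps_nth (even_fps e) (n - j))) = 0"
      by (intro sum.neutral) auto
    then show ?case using less.prems by (subst main) (simp add: even_fps_nth)
  qed
  have c_odd: "2 * \<gamma> * (T_weight q \<gamma> (2 * n - 1) * e n) = c n" if n: "n \<ge> 1" for n
    using T_weight_odd[of \<gamma> q "n - 1"] n
    by (cases n) (auto simp: c_def mult_ac)
  have rec: "\<gamma> * M (2 * n) + \<gamma> * (\<Sum>j<n. M (2 * j) * c (n - j)) = (\<gamma> + real n) * c n" if n: "n \<ge> 1" for n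
  proof -
    have "2 * \<gamma> * (\<Sum>j<2 * n. M j * (T_weight q \<gamma> (2 * n - 1 - j) * fps_nth (even_fps e) (2 * n - j)))
      = 2 * \<gamma> * (\<Sum>j<n. M (2 * j) * (T_weight q \<gamma> (2 * n - 1 - 2 * j) * fps_nth (even_fps e) (2 * n - 2 * j)))"
      by (subst sum_lessThan_double) (auto simp: \<open>\<And>n. odd n \<Longrightarrow> M n = 0\<close>)
    also have "\<dots> = (\<Sum>j<n. M (2 * j) * c (n - j))"
      unfolding sum_distrib_left
    proof (intro sum.cong refl)
      fix j assume "j \<in> {..<n}"
      then have "n - j \<ge> 1" "2 * n - 1 - 2 * j = 2 * (n - j) - 1" "2 * n - 2 * j = 2 * (n - j)" by auto
      then show "2 * \<gamma> * (M (2 * j) * (T_weight q \<gamma> (2 * n - 1 - 2 * j) * fps_nth (even_fps e) (2 * n - 2 * j)))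
        = M (2 * j) * c (n - j)"
        using c_odd[of "n - j"] by (simp add: even_fps_nth mult_ac)
    qed
    finally have "M (2 * n) + (\<Sum>j<n. M (2 * j) * c (n - j)) = T_weight q \<gamma> (2 * n) * e n"
      by (subst main) (simp add: even_fps_nth)
    moreover have "\<gamma> * (T_weight q \<gamma> (2 * n) * e n) = (\<gamma> + real n) * c n"
    proof -
      \<comment> \<open>Splitting off the last, even-indexed factor leaves an odd weight, to which
        \<open>c_odd\<close> applies.\<close>
      have "T_weight q \<gamma> (2 * n) = T_weight q \<gamma> (2 * n - 1) * (2 * real n + 2 * \<gamma>)"
        using n T_weight_Suc[of q \<gamma> "2 * n - 1"] by (simp add: T_coeff_def)
      then have "\<gamma> * (T_weight q \<gamma> (2 * n) * e n)
          = (2 * \<gamma> * (T_weight q \<gamma> (2 * n - 1) * e n)) * (\<gamma> + real n)"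
        by (simp add: algebra_simps)
      then show ?thesis unfolding c_odd[OF n] by (simp add: mult.commute)
    qed
    ultimately show ?thesis by (simp flip: distrib_left)
  qed
  have "exp_seq (\<lambda>k. \<gamma> * (T_kappa_to_m q \<gamma> \<kappa> k / real k)) = c"
  proof (rule exp_seq_eqI)
    show "c 0 = 1" by (simp add: c_def e0)
  next
    fix n :: nat assume n: "n \<ge> 1"
    have "(\<Sum>j<n. c j * (real (n - j) * (\<gamma> * (T_kappa_to_m q \<gamma> \<kappa> (n - j) / real (n - j)))))
        = (\<Sum>j<n. \<gamma> * M (2 * (n - j)) * c j)"
      by (intro sum.cong refl) (auto simp: T_kappa_to_m_eq M_def g_def)
    also have "\<dots> = (\<Sum>j\<in>{1..n}. \<gamma> * M (2 * j) * c (n - j))"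
      by (rule sum.reindex_bij_witness[of _ "\<lambda>j. n - j" "\<lambda>j. n - j"]) auto
    also have "\<dots> = real n * c n"
    proof -
      \<comment> \<open>Summand j = n is \<gamma> M(2n) because c(0) = 1. Summand j = 0 is \<gamma>
        c(n) because M(0) = 1; cancelling it leaves n c(n).\<close>
      have "(\<Sum>j\<in>{..n}. \<gamma> * M (2 * j) * c (n - j)) = (\<gamma> + real n) * c n"
        using rec[OF n] by (simp add: lessThan_Suc_atMost[symmetric] sum_distrib_left c_def e0 mult_ac)
      moreover have "{..n} = insert 0 {1..n}" by auto
      moreover have "M 0 = 1" by (simp add: M_def)
      ultimately show ?thesis by (simp add: algebra_simps)
    qed
    finally show "real n * c n
      = (\<Sum>j<n. c j * (real (n - j) * (\<gamma> * (T_kappa_to_m q \<gamma> \<kappa> (n - j) / real (n - j)))))" by simp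
  qed
  then show ?thesis by (simp add: c_def e_def)
qed

section \<open>Existence and uniqueness of the inverse map\<close>

text \<open>The weights are nonzero by positivity, so dividing by them and taking the logarithm
  recovers the even-indexed terms.\<close>

lemma T_kappa_to_m_ex1:
  assumes "q \<ge> 1" "\<gamma> > 0"
  shows "\<exists>!\<kappa>. \<kappa> 0 = 0 \<and> (\<forall>l. odd l \<longrightarrow> \<kappa> l = 0) \<and> (\<forall>k\<ge>1. T_kappa_to_m q \<gamma> \<kappa> k = M k)"
proof -
  define w where "w = (\<lambda>n. pochhammer \<gamma> n * pochhammer (q * \<gamma>) n * 4 ^ n)"
  have w: "w n \<noteq> 0" for n
    using assms by (simp add: w_def pochhammer_pos less_imp_neq[symmetric])
  have rel: "exp_seq (\<lambda>k. \<gamma> * (T_kappa_to_m q \<gamma> \<kappa> k / real k)) n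
      = w n * exp_seq (\<lambda>l. \<kappa> (2 * l) / real (2 * l)) n" if "\<forall>l. odd l \<longrightarrow> \<kappa> l = 0" for \<kappa> n
    using exp_seq_T_kappa_to_m[of \<gamma> \<kappa> q n] assms that by (simp add: w_def)
  obtain a where a: "exp_seq a = (\<lambda>n. exp_seq (\<lambda>k. \<gamma> * (M k / real k)) n / w n)"
    by (rule exp_seq_surj[of "\<lambda>n. exp_seq (\<lambda>k. \<gamma> * (M k / real k)) n / w n"]) (auto simp: w_def)
  \<comment> \<open>Inverts a(l) = \<kappa>(2l)/(2l); the factor \<open>real l\<close> also gives
    the value 0 at index 0.\<close>
  define \<kappa> where "\<kappa> = (\<lambda>l. if even l then real l * a (l div 2) else 0)"
  show ?thesis
  proof (rule ex1I[of _ \<kappa>])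
    have "exp_seq (\<lambda>l. \<kappa> (2 * l) / real (2 * l)) = exp_seq a"
      by (rule exp_seq_cong) (simp add: \<kappa>_def)
    then have eq: "exp_seq (\<lambda>k. \<gamma> * (T_kappa_to_m q \<gamma> \<kappa> k / real k)) = exp_seq (\<lambda>k. \<gamma> * (M k / real k))"
      using rel[of \<kappa>] w by (auto simp: a \<kappa>_def fun_eq_iff)
    show "\<kappa> 0 = 0 \<and> (\<forall>l. odd l \<longrightarrow> \<kappa> l = 0) \<and> (\<forall>k\<ge>1. T_kappa_to_m q \<gamma> \<kappa> k = M k)"
      using exp_seq_inj[OF eq] assms by (auto simp: \<kappa>_def)
  next
    fix \<kappa>' assume \<kappa>': "\<kappa>' 0 = 0 \<and> (\<forall>l. odd l \<longrightarrow> \<kappa>' l = 0) \<and> (\<forall>k\<ge>1. T_kappa_to_m q \<gamma> \<kappa>' k = M k)"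
    have "exp_seq (\<lambda>k. \<gamma> * (T_kappa_to_m q \<gamma> \<kappa>' k / real k)) = exp_seq (\<lambda>k. \<gamma> * (M k / real k))"
      using \<kappa>' by (intro exp_seq_cong) auto
    then have eq: "exp_seq (\<lambda>l. \<kappa>' (2 * l) / real (2 * l)) = exp_seq a"
      using rel[of \<kappa>'] \<kappa>' w by (auto simp: a fun_eq_iff)
    show "\<kappa>' = \<kappa>"
    proof
      fix l
      show "\<kappa>' l = \<kappa> l"
        using exp_seq_inj[OF eq, of "l div 2"] \<kappa>'
        by (cases "l = 0"; cases "even l") (auto simp: \<kappa>_def field_simps elim!: evenE)
    qed
  qed
qed

section \<open>Coefficient extraction and the final identities\<close>

text \<open>With \<open>F\<close> a series in 1/z, only its coefficient of z^(-2n) pairs with z^(2n)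
  to give z^0.\<close>

lemma coeff_z0_even_fps:
  "coeff_z0 (even_fps (\<lambda>n. fls_const (b n) * fls_X_inv ^ (2 * n)) * fps_const (fps_to_fls F))
    = even_fps (\<lambda>n. b n * fps_nth F (2 * n))"
proof (rule fps_ext)
  fix j
  have [simp]: "fls_nth (fls_X_inv ^ (2 * n) * fps_to_fls F) 0 = fps_nth F (2 * n)" for n
    by (simp add: fls_X_inv_power_times_conv_shift(1) nat_mult_distrib)
  show "fps_nth (coeff_z0 (even_fps (\<lambda>n. fls_const (b n) * fls_X_inv ^ (2 * n)) * fps_const (fps_to_fls F))) j
    = fps_nth (even_fps (\<lambda>n. b n * fps_nth F (2 * n))) j"
    by (auto simp: coeff_z0_def even_fps_nth mult.assoc)
qed

theorem theorem5p9:
  fixes q \<gamma> :: real and m \<kappa> :: "nat \<Rightarrow> real"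
  assumes "q \<ge> 1" and "\<gamma> > 0"
    and "\<forall>l\<ge>1. \<kappa> l = T_m_to_kappa q \<gamma> (\<lambda>k. m (2 * k)) l"
  shows "(\<forall>l. odd l \<longrightarrow> \<kappa> l = 0) \<and>
    (\<exists>c :: nat \<Rightarrow> real.
       exp_fps (fps_const \<gamma> * even_fps1 (\<lambda>k. m (2 * k) / real k)) = even_fps c \<and>
       exp_fps (even_fps1 (\<lambda>l. \<kappa> (2 * l) / real (2 * l))) =
         even_fps (\<lambda>n. c n / (pochhammer \<gamma> n * pochhammer (q * \<gamma>) n) / 2 ^ (2 * n))) \<and>
    exp_fps (even_fps1 (\<lambda>l. \<kappa> (2 * l) / real (2 * l))) =
      coeff_z0
        (even_fps (\<lambda>n. fls_const (1 / (pochhammer \<gamma> n * pochhammer (q * \<gamma>) n) / 2 ^ (2 * n))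
                        * fls_X_inv ^ (2 * n))
         * fps_const (fps_to_fls
             (exp_fps (fps_const \<gamma> * even_fps1 (\<lambda>k. m (2 * k) / real k)))))"
proof -
  define M where "M = (\<lambda>k. m (2 * k))"
  define c where "c = exp_seq (\<lambda>k. \<gamma> * (M k / real k))"
  let ?w = "\<lambda>n. pochhammer \<gamma> n * pochhammer (q * \<gamma>) n"
  have "T_m_to_kappa q \<gamma> M 0 = 0 \<and> (\<forall>l. odd l \<longrightarrow> T_m_to_kappa q \<gamma> M l = 0)
      \<and> (\<forall>k\<ge>1. T_kappa_to_m q \<gamma> (T_m_to_kappa q \<gamma> M) k = M k)"
    using theI'[OF T_kappa_to_m_ex1[OF assms(1,2), of M]] unfolding T_m_to_kappa_def .
  \<comment> \<open>The map reads its argument only at positive indices, where the two sequences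
    agree by assumption.\<close>
  moreover have "T_kappa_to_m q \<gamma> \<kappa> = T_kappa_to_m q \<gamma> (T_m_to_kappa q \<gamma> M)"
    using assms(3) by (simp add: T_kappa_to_m_def M_def fun_eq_iff)
  ultimately have odd: "\<forall>l. odd l \<longrightarrow> \<kappa> l = 0" and T: "\<forall>k\<ge>1. T_kappa_to_m q \<gamma> \<kappa> k = M k"
    using assms(3) by (auto simp: M_def elim!: oddE)
  have c: "exp_fps (fps_const \<gamma> * even_fps1 (\<lambda>k. m (2 * k) / real k)) = even_fps c"
  proof -
    have "fps_const \<gamma> * even_fps1 (\<lambda>k. M k / real k) = even_fps1 (\<lambda>k. \<gamma> * (M k / real k))"
      by (rule fps_ext) (simp add: even_fps1_def even_fps_nth)
    then show ?thesis by (simp add: exp_fps_even_fps1 c_def M_def)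
  qed
  have w: "?w n \<noteq> 0" for n
    using assms by (simp add: pochhammer_pos less_imp_neq[symmetric])
  have "c = exp_seq (\<lambda>k. \<gamma> * (T_kappa_to_m q \<gamma> \<kappa> k / real k))"
    unfolding c_def by (rule exp_seq_cong) (simp add: T)
  then have "exp_seq (\<lambda>l. \<kappa> (2 * l) / real (2 * l)) n = c n / ?w n / 2 ^ (2 * n)" for n
    using exp_seq_T_kappa_to_m[of \<gamma> \<kappa> q n] odd assms(2) w[of n]
    by (simp add: power_mult)
  then have \<kappa>: "exp_fps (even_fps1 (\<lambda>l. \<kappa> (2 * l) / real (2 * l)))
      = even_fps (\<lambda>n. c n / ?w n / 2 ^ (2 * n))"
    unfolding exp_fps_even_fps1 by (intro arg_cong[of _ _ even_fps] ext)
  show ?thesis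
    unfolding coeff_z0_even_fps unfolding c \<kappa> using odd by (auto simp: even_fps_nth)
qed

end
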